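(* Let $\Gamma=\pi_1S$ be the fundamental group of a closed oriented surface $S$ of genus $g\ge2$, let $n\ge2$, $G'=\mathrm{PSO}(n,n)$, and let $\varrho:\Gamma\to G'$ be a $G'$-Hitchin representation. Then the $\varrho$-equivariant positive curve $\xi:\partial\Gamma\to\mathcal F_{B'}$ satisfies $$\xi^{(n-1)}(x)+\left(\xi^{(n-1)}(z)\cap\xi^{(n+2)}(y)\right)+\xi_\pm^{(n)}(y)=\mathbb{R}^{2n}$$ (for both choices of sign) for all pairwise distinct triples $(y,z,x)$ in $\partial\Gamma$.
   Context: $\mathbb{R}^{n,n}$ is $\mathbb{R}^{2n}$ with the form $\langle x,y\rangle_{n,n}=\sum_{i=1}^{2n}x_iy_{2n+1-i}$ of signature $(n,n)$ in the standard basis $e_1,\dots,e_{2n}$; $\mathrm{SO}(n,n)<\mathrm{SL}(2n,\mathbb{R})$ is its determinant-one automorphism group and $\mathrm{PSO}(n,n)$ the image in $\mathrm{PSL}(2n,\mathbb{R})$. Isotropic $n$-planes. For an isotropic $n$-plane $H$ with basis $v_1,\dots,v_n$, let $v_1',\dots,v_n'$ span an isotropic $n$-plane with $\langle v_i,v_j'\rangle=\delta_{ij}$; $H$ is called positive (resp. negative) if $v_1\wedge\dots\wedge v_n\wedge v_n'\wedge\dots\wedge v_1'$ is $+1$ (resp. $-1$) times $e_1\wedge\dots\wedge e_{2n}$ (independent of choices). Every isotropic $(n-1)$-plane is contained in a unique positive and a unique negative isotropic $n$-plane. Flags. For a Borel subgroup $B'<G'$, $\mathcal F_{B'}=G'/B'$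 is the space of flags $F$: $F^{(1)}\subset\dots\subset F^{(n-1)}\subset F_+^{(n)},F_-^{(n)}\subset F^{(n+1)}\subset\dots\subset F^{(2n-1)}$ where $F^{(k)}$ is an isotropic $k$-plane for $k\le n-1$, $F^{(2n-k)}=(F^{(k)})^\perp$, and $F_+^{(n)}$, $F_-^{(n)}$ are the positive and negative isotropic $n$-planes containing $F^{(n-1)}$; set $F^{(2n)}=\mathbb{R}^{2n}$. For $\xi:\partial\Gamma\to\mathcal F_{B'}$ write $\xi^{(k)}(x)=\xi(x)^{(k)}$ and $\xi^{(n)}_\pm(x)=\xi(x)^{(n)}_\pm$. Hitchin representations. A subalgebra of the Lie algebra $\mathfrak g'$ of $G'$ isomorphic to $\mathfrak{sl}(2,\mathbb{R})$ is principal if each of its non-zero elements has centralizer in $\mathfrak g'$ of minimal dimension. Let $\tau_{G'}:\mathrm{PSL}(2,\mathbb{R})\to G'$ be an injective homomorphism whose image has principal Lie algebra; for instance, the composition of the irreducible representation $\mathrm{PSL}(2,\mathbb{R})\to\mathrm{SO}(n,n-1)$ with the map $\mathrm{SO}(n,n-1)\to\mathrm{PSO}(n,n)$ coming from an orthogonal splitting $\mathbb{R}^{n,n}=\mathbb{R}^{n,n-1}\oplus\mathbb{R}^{0,1}$ (trivial action on $\mathbb{R}^{0,1}$). A $G'$-Hitchin representation is one whose conjugacy class lies in the connected component of $\mathrm{Hom}(\Gamma,G')/G'$ containing the classes $[\tau_{G'}\circ j]$, with $j:\Gamma\to\mathrm{PSL}(2,\mathbb{R})$ discrete and faithful corresponding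 to hyperbolic structures on the oriented surface $S$ (for any fixed choice of $\tau_{G'}$). Positive curve. $\partial\Gamma$ is the Gromov boundary of $\Gamma$, a circle. A $G'$-Hitchin representation $\varrho$ admits a continuous $\varrho$-equivariant curve $\xi:\partial\Gamma\to\mathcal F_{B'}$ sending cyclically positively ordered triples to positive triples of flags (positivity in the sense of Lusztig and Fock–Goncharov); it is called the positive curve of $\varrho$. It coincides with the Anosov limit map of $\varrho$ with respect to $B'$, and so is characterized as the unique continuous $\varrho$-equivariant map $\partial\Gamma\to\mathcal F_{B'}$ which for every $\gamma\in\Gamma\setminus\{1\}$ sends the attracting fixed point of $\gamma$ in $\partial\Gamma$ to the unique attracting fixed point of $\varrho(\gamma)$ in $\mathcal F_{B'}$. *)

theory Defs
  imports
    "HOL-Complex_Analysis.Complex_Analysis"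
    "HOL-Homology.Homology"
    "HOL-Library.Set_Algebras"
begin

section \<open>The form of signature (n,n), isotropic planes and flags\<close>

text \<open>
  The space $R^{n,n}$ is \<open>real ^ ('n + 'n)\<close> with \<open>n = CARD('n)\<close>. For an enumeration
  $i_1, \dots, i_n$ of \<open>'n\<close>, the basis vector $e_k$ is the axis \<open>Inl i\<^sub>k\<close> and
  $e_{2n+1-k}$ is the axis \<open>Inr i\<^sub>k\<close>, for $1 \le k \le n$. Neither the form nor the sign of an
  isotropic n-plane depends on the enumeration.
\<close>

type_synonym 'n vec2 = "real ^ ('n + 'n)"
type_synonym 'n mat2 = "real ^ ('n + 'n) ^ ('n + 'n)"

definition form :: "'n::finite vec2 \<Rightarrow> 'n vec2 \<Rightarrow> real" where
  "form x y = (\<Sum>i\<in>UNIV. x $ Inl i * y $ Inr i + x $ Inr i * y $ Inl i)"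

definition perp :: "'n::finite vec2 set \<Rightarrow> 'n vec2 set" where
  "perp V = {w. \<forall>v\<in>V. form v w = 0}"

definition isotropic_plane :: "nat \<Rightarrow> 'n::finite vec2 set \<Rightarrow> bool" where
  "isotropic_plane k V \<longleftrightarrow> subspace V \<and> dim V = k \<and> (\<forall>v\<in>V. \<forall>w\<in>V. form v w = 0)"

text \<open>
  The wedge $v_1 \wedge \dots \wedge v_n \wedge v_n' \wedge \dots \wedge v_1'$ is the determinant below
  times $e_1 \wedge \dots \wedge e_{2n}$: rows and columns are indexed by \<open>'n + 'n\<close> in the same order.
\<close>

definition signed_plane :: "real \<Rightarrow> 'n::finite vec2 set \<Rightarrow> bool" where
  "signed_plane s H \<longleftrightarrow> isotropic_plane CARD('n) H \<and>
     (\<exists>v v' :: 'n \<Rightarrow> 'n vec2.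
        span (range v) = H \<and>
        (\<forall>i j. form (v' i) (v' j) = 0) \<and>
        (\<forall>i j. form (v i) (v' j) = (if i = j then 1 else 0)) \<and>
        det (\<chi> r c. (case c of Inl i \<Rightarrow> v i $ r | Inr i \<Rightarrow> v' i $ r)) = s)"

definition positive_plane :: "'n::finite vec2 set \<Rightarrow> bool" where
  "positive_plane = signed_plane 1"

definition negative_plane :: "'n::finite vec2 set \<Rightarrow> bool" where
  "negative_plane = signed_plane (-1)"

text \<open>
  A flag stores $F^{(k)}$ for \<open>k \<noteq> n\<close> in \<open>fsub\<close> and $F^{(n)}_\pm$ in \<open>fpos\<close>, \<open>fneg\<close>.
  The meaningless entries of \<open>fsub\<close> (index \<open>n\<close> and indices above \<open>2n\<close>) are empty,
  so that equality of flags is equality of records.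
\<close>

record 'n flag =
  fsub :: "nat \<Rightarrow> 'n vec2 set"
  fpos :: "'n vec2 set"
  fneg :: "'n vec2 set"

definition flags :: "'n::finite flag set" where
  "flags = {F.
     (\<forall>k<CARD('n). isotropic_plane k (fsub F k)) \<and>
     (\<forall>k. Suc k < CARD('n) \<longrightarrow> fsub F k \<subseteq> fsub F (Suc k)) \<and>
     (\<forall>k<CARD('n). fsub F (2 * CARD('n) - k) = perp (fsub F k)) \<and>
     positive_plane (fpos F) \<and> fsub F (CARD('n) - 1) \<subseteq> fpos F \<and>
     negative_plane (fneg F) \<and> fsub F (CARD('n) - 1) \<subseteq> fneg F \<and>
     fsub F CARD('n) = {} \<and> (\<forall>k>2 * CARD('n). fsub F k = {})}"

definition flag_image :: "'n::finite mat2 \<Rightarrow> 'n flag \<Rightarrow> 'n flag" where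
  "flag_image A F = \<lparr>fsub = (\<lambda>k. (*v) A ` fsub F k), fpos = (*v) A ` fpos F, fneg = (*v) A ` fneg F\<rparr>"

text \<open>
  The Grassmannians carry the topology in which a subspace is identified with the orthogonal
  projection onto it; the flag variety is a compact subspace of a product of Grassmannians.
\<close>

definition orth_proj :: "'n::finite vec2 set \<Rightarrow> 'n mat2" where
  "orth_proj V = matrix (closest_point V)"

definition continuous_flag_map :: "'b topology \<Rightarrow> ('b \<Rightarrow> 'n::finite flag) \<Rightarrow> bool" where
  "continuous_flag_map X \<xi> \<longleftrightarrow> \<xi> \<in> topspace X \<rightarrow> flags \<and>
     (\<forall>k \<le> 2 * CARD('n). k \<noteq> CARD('n) \<longrightarrow>
        continuous_map X euclidean (\<lambda>x. orth_proj (fsub (\<xi> x) k))) \<and>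
     continuous_map X euclidean (\<lambda>x. orth_proj (fpos (\<xi> x))) \<and>
     continuous_map X euclidean (\<lambda>x. orth_proj (fneg (\<xi> x)))"


section \<open>Positive triples of flags\<close>

text \<open>
  Pinnings of $so(n,n)$ are given by bases \<open>b 1, \<dots>, b (2n)\<close> with
  \<open>form (b i) (b j) = \<mu>\<close> for \<open>i + j = 2n + 1\<close> and \<open>0\<close> otherwise, where \<open>\<mu> = 1\<close> or \<open>\<mu> = -1\<close>.
  Both signs are needed: positivity is a notion of the adjoint group, whose real points
  contain anti-isometries, and with \<open>\<mu> = 1\<close> alone one of the two \<open>PSO(n,n)\<close>-classes
  of pinnings would be missed. Bases with \<open>b 1, \<dots>, b n\<close> spanning a negative
  n-plane only exchange the names of the last two simple roots.
\<close>

definition pinning_basis :: "(nat \<Rightarrow> 'n::finite vec2) \<Rightarrow> real \<Rightarrow> bool" where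
  "pinning_basis b \<mu> \<longleftrightarrow> \<mu> \<in> {1, -1} \<and>
     (\<forall>i\<in>{1..2 * CARD('n)}. \<forall>j\<in>{1..2 * CARD('n)}.
        form (b i) (b j) = (if i + j = 2 * CARD('n) + 1 then \<mu> else 0))"

text \<open>
  Simple root vectors. In coordinates with respect to \<open>b\<close>, for \<open>i < n\<close> the \<open>i\<close>-th maps
  $b_{i+1} \mapsto b_i$ and $b_{2n+1-i} \mapsto -b_{2n-i}$; the \<open>n\<close>-th maps
  $b_{n+1} \mapsto b_{n-1}$ and $b_{n+2} \mapsto -b_n$; the other basis vectors go to 0.
\<close>

definition root_vector :: "(nat \<Rightarrow> 'n::finite vec2) \<Rightarrow> real \<Rightarrow> nat \<Rightarrow> 'n vec2 \<Rightarrow> 'n vec2" where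
  "root_vector b \<mu> i v =
     (let p = (if i < CARD('n) then b i else b (CARD('n) - 1));
          q = (if i < CARD('n) then b (2 * CARD('n) - i) else b CARD('n))
      in \<mu> *\<^sub>R (form v q *\<^sub>R p - form v p *\<^sub>R q))"

text \<open>The exponential of \<open>a\<close> times a simple root vector, whose square is 0.\<close>

definition root_group :: "(nat \<Rightarrow> 'n::finite vec2) \<Rightarrow> real \<Rightarrow> nat \<Rightarrow> real \<Rightarrow> 'n vec2 \<Rightarrow> 'n vec2" where
  "root_group b \<mu> i a v = v + a *\<^sub>R root_vector b \<mu> i v"

text \<open>The Weyl group of type $D_n$, acting on the indices \<open>1, \<dots>, 2n\<close> of a pinning basis.\<close>

definition simple_reflection :: "nat \<Rightarrow> nat \<Rightarrow> nat \<Rightarrow> nat" where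
  "simple_reflection n i =
     (if i < n
      then Transposition.transpose i (i + 1) \<circ> Transposition.transpose (2 * n - i) (2 * n + 1 - i)
      else Transposition.transpose (n - 1) (n + 1) \<circ> Transposition.transpose n (n + 2))"

definition weyl_word :: "nat \<Rightarrow> nat list \<Rightarrow> nat \<Rightarrow> nat" where
  "weyl_word n is = foldr (\<lambda>i w. simple_reflection n i \<circ> w) is id"

definition reduced_word :: "nat \<Rightarrow> nat list \<Rightarrow> bool" where
  "reduced_word n is \<longleftrightarrow> set is \<subseteq> {1..n} \<and>
     (\<forall>js. set js \<subseteq> {1..n} \<and> weyl_word n js = weyl_word n is \<longrightarrow> length is \<le> length js)"

text \<open>
  The longest element of the Weyl group is the one taking the coordinate flag
  $\langle b_1 \rangle \subset \dots \subset \langle b_1, \dots, b_{n-1} \rangle$ to the opposite one;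
  its values at \<open>n\<close> and \<open>n + 1\<close>, which depend on the parity of \<open>n\<close>, are then forced.
\<close>

definition longest_word :: "nat \<Rightarrow> nat list \<Rightarrow> bool" where
  "longest_word n is \<longleftrightarrow> reduced_word n is \<and> (\<forall>k\<in>{1..<n}. weyl_word n is k = 2 * n + 1 - k)"

text \<open>Lusztig's totally positive part of the unipotent radical fixing the flag of the first basis vectors.\<close>

definition totally_positive :: "(nat \<Rightarrow> 'n::finite vec2) \<Rightarrow> real \<Rightarrow> ('n vec2 \<Rightarrow> 'n vec2) set" where
  "totally_positive b \<mu> =
     {foldr (\<lambda>(i, a) u. root_group b \<mu> i a \<circ> u) (zip is as) id | is as.
        longest_word CARD('n) is \<and> length as = length is \<and> (\<forall>a\<in>set as. a > 0)}"

text \<open>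
  A triple is positive if it is $(F, u E, E)$ where $F$, $E$ are the opposite flags fixed by the Borel
  subgroups of a pinning and $u$ is totally positive. It suffices to compare the subspaces of
  dimension less than \<open>n\<close>, since these determine the flag.
\<close>

definition positive_triple :: "'n::finite flag \<Rightarrow> 'n flag \<Rightarrow> 'n flag \<Rightarrow> bool" where
  "positive_triple F\<^sub>1 F\<^sub>2 F\<^sub>3 \<longleftrightarrow> F\<^sub>1 \<in> flags \<and> F\<^sub>2 \<in> flags \<and> F\<^sub>3 \<in> flags \<and>
     (\<exists>b \<mu>. \<exists>u\<in>totally_positive b \<mu>. pinning_basis b \<mu> \<and>
        (\<forall>k<CARD('n).
           fsub F\<^sub>1 k = span (b ` {1..k}) \<and>
           fsub F\<^sub>3 k = span (b ` {2 * CARD('n) + 1 - k..2 * CARD('n)}) \<and>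
           fsub F\<^sub>2 k = u ` fsub F\<^sub>3 k))"


section \<open>The groups PSL(2,R) and PSO(n,n)\<close>

definition quotient_top :: "'a topology \<Rightarrow> ('a \<Rightarrow> 'b) \<Rightarrow> 'b topology" where
  "quotient_top X q = topology (\<lambda>U. U \<subseteq> q ` topspace X \<and> openin X {x \<in> topspace X. q x \<in> U})"

lemma openin_quotient_top:
  "openin (quotient_top X q) U \<longleftrightarrow> U \<subseteq> q ` topspace X \<and> openin X {x \<in> topspace X. q x \<in> U}"
proof -
  have "istopology (\<lambda>U. U \<subseteq> q ` topspace X \<and> openin X {x \<in> topspace X. q x \<in> U})"
    unfolding istopology_def
  proof (intro conjI allI impI)
    fix U V assume "U \<subseteq> q ` topspace X \<and> openin X {x \<in> topspace X. q x \<in> U}"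
      and "V \<subseteq> q ` topspace X \<and> openin X {x \<in> topspace X. q x \<in> V}"
    moreover have "{x \<in> topspace X. q x \<in> U \<inter> V} =
        {x \<in> topspace X. q x \<in> U} \<inter> {x \<in> topspace X. q x \<in> V}" by auto
    ultimately show "U \<inter> V \<subseteq> q ` topspace X" "openin X {x \<in> topspace X. q x \<in> U \<inter> V}"
      by auto
  next
    fix \<K> assume *: "\<forall>K\<in>\<K>. K \<subseteq> q ` topspace X \<and> openin X {x \<in> topspace X. q x \<in> K}"
    then show "\<Union>\<K> \<subseteq> q ` topspace X" by blast
    have "{x \<in> topspace X. q x \<in> \<Union>\<K>} = (\<Union>K\<in>\<K>. {x \<in> topspace X. q x \<in> K})" by auto
    then show "openin X {x \<in> topspace X. q x \<in> \<Union>\<K>}" using * by auto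
  qed
  then show ?thesis by (simp add: quotient_top_def topology_inverse')
qed

definition matrix_group :: "(real ^ 'm::finite ^ 'm) set \<Rightarrow> (real ^ 'm ^ 'm) monoid" where
  "matrix_group K = \<lparr>carrier = K, monoid.mult = (**), one = mat 1\<rparr>"

text \<open>Elements of the projectivised groups are the cosets \<open>{A, - A}\<close>.\<close>

definition projective_group :: "(real ^ 'm::finite ^ 'm) set \<Rightarrow> (real ^ 'm ^ 'm) set monoid" where
  "projective_group K = matrix_group K Mod {mat 1, - mat 1}"

definition projective_top :: "(real ^ 'm::finite ^ 'm) set \<Rightarrow> (real ^ 'm ^ 'm) set topology" where
  "projective_top K = quotient_top (top_of_set K) (\<lambda>A. {A, - A})"

definition SL2 :: "(real ^ 2 ^ 2) set" where
  "SL2 = {A. det A = 1}"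

definition SO_nn :: "'n::finite mat2 set" where
  "SO_nn = {A. (\<forall>v w. form (A *v v) (A *v w) = form v w) \<and> det A = 1}"

abbreviation "PSL2 \<equiv> projective_group SL2"
abbreviation "PSL2_top \<equiv> projective_top SL2"
abbreviation "PSO_nn \<equiv> projective_group SO_nn"
abbreviation "PSO_nn_top \<equiv> projective_top SO_nn"


section \<open>Principal embeddings of PSL(2,R)\<close>

text \<open>The Lie algebra of a group of matrices, through its differentiable one-parameter subgroups.\<close>

definition lie_algebra :: "(real ^ 'm::finite ^ 'm) set \<Rightarrow> (real ^ 'm ^ 'm) set" where
  "lie_algebra K = {X. \<exists>c :: real \<Rightarrow> real ^ 'm ^ 'm.
     (\<forall>t. c t \<in> K) \<and> c 0 = mat 1 \<and> (\<forall>s t. c (s + t) = c s ** c t) \<and>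
     (c has_vector_derivative X) (at 0)}"

definition bracket :: "real ^ 'm::finite ^ 'm \<Rightarrow> real ^ 'm ^ 'm \<Rightarrow> real ^ 'm ^ 'm" where
  "bracket X Y = X ** Y - Y ** X"

definition sl2 :: "(real ^ 2 ^ 2) set" where
  "sl2 = {X. trace X = 0}"

definition centralizer_in :: "(real ^ 'm::finite ^ 'm) set \<Rightarrow> real ^ 'm ^ 'm \<Rightarrow> (real ^ 'm ^ 'm) set" where
  "centralizer_in \<gg> X = {Y \<in> \<gg>. bracket X Y = 0}"

definition principal_subalgebra ::
    "(real ^ 'm::finite ^ 'm) set \<Rightarrow> (real ^ 'm ^ 'm) set \<Rightarrow> bool" where
  "principal_subalgebra \<gg> \<ss> \<longleftrightarrow> \<ss> \<subseteq> \<gg> \<and>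
     (\<exists>f. linear f \<and> bij_betw f sl2 \<ss> \<and>
        (\<forall>X\<in>sl2. \<forall>Y\<in>sl2. f (bracket X Y) = bracket (f X) (f Y))) \<and>
     (\<forall>X\<in>\<ss> - {0}. \<forall>Y\<in>\<gg>. dim (centralizer_in \<gg> X) \<le> dim (centralizer_in \<gg> Y))"

text \<open>
  \<open>PSO(n,n)\<close> and \<open>SO(n,n)\<close> have the same Lie algebra, so that of the image of \<open>\<tau>\<close>
  is computed in the preimage \<open>\<Union>(\<tau> ` carrier PSL2)\<close> of this image in \<open>SO(n,n)\<close>.
  Homomorphisms of Lie groups are understood to be continuous.
\<close>

definition principal_embedding :: "((real ^ 2 ^ 2) set \<Rightarrow> 'n::finite mat2 set) \<Rightarrow> bool" where
  "principal_embedding \<tau> \<longleftrightarrow>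
     \<tau> \<in> hom PSL2 PSO_nn \<and> inj_on \<tau> (carrier PSL2) \<and> continuous_map PSL2_top PSO_nn_top \<tau> \<and>
     principal_subalgebra (lie_algebra SO_nn) (lie_algebra (\<Union>(\<tau> ` carrier PSL2)))"


section \<open>Closed oriented surfaces and their fundamental groups\<close>

text \<open>
  A map between open subsets of the plane that is continuous and injective near \<open>z\<close>
  preserves the orientation at \<open>z\<close> if it maps small circles around \<open>z\<close> to loops with
  winding number 1.
\<close>

definition orientation_preserving_at :: "(complex \<Rightarrow> complex) \<Rightarrow> complex \<Rightarrow> bool" where
  "orientation_preserving_at f z \<longleftrightarrow>
     (\<forall>\<^sub>F r in at_right 0. winding_number (f \<circ> circlepath z r) (f z) = 1)"

definition oriented_atlas :: "'s::t2_space set \<Rightarrow> ('s set \<times> ('s \<Rightarrow> complex)) set \<Rightarrow> bool" where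
  "oriented_atlas S \<A> \<longleftrightarrow>
     (\<Union>(U, \<phi>)\<in>\<A>. U) = S \<and>
     (\<forall>(U, \<phi>)\<in>\<A>. openin (top_of_set S) U \<and> open (\<phi> ` U) \<and> (\<exists>\<psi>. homeomorphism U (\<phi> ` U) \<phi> \<psi>)) \<and>
     (\<forall>(U, \<phi>)\<in>\<A>. \<forall>(V, \<psi>)\<in>\<A>. \<forall>x\<in>U \<inter> V. orientation_preserving_at (\<psi> \<circ> inv_into U \<phi>) (\<phi> x))"

text \<open>The genus is half the rank of the first integral homology group.\<close>

definition closed_oriented_surface ::
    "nat \<Rightarrow> 's::t2_space set \<Rightarrow> ('s set \<times> ('s \<Rightarrow> complex)) set \<Rightarrow> bool" where
  "closed_oriented_surface g S \<A> \<longleftrightarrow>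
     compact S \<and> connected S \<and> oriented_atlas S \<A> \<and>
     homology_group 1 (top_of_set S) \<cong> free_Abelian_group {..<2 * g}"

definition fundamental_group :: "'s::t2_space set \<Rightarrow> 's \<Rightarrow> (real \<Rightarrow> 's) set monoid" where
  "fundamental_group S s\<^sub>0 =
     \<lparr>carrier = {{q. homotopic_paths S p q} | p.
         path p \<and> path_image p \<subseteq> S \<and> pathstart p = s\<^sub>0 \<and> pathfinish p = s\<^sub>0},
      monoid.mult = (\<lambda>X Y. {r. \<exists>p\<in>X. \<exists>q\<in>Y. homotopic_paths S (p +++ q) r}),
      one = {q. homotopic_paths S (\<lambda>_. s\<^sub>0) q}\<rparr>"


section \<open>Hyperbolic structures and Hitchin representations\<close>

definition upper_half_plane :: "complex set" where
  "upper_half_plane = {z. Im z > 0}"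

definition moebius_act :: "real ^ 2 ^ 2 \<Rightarrow> complex \<Rightarrow> complex" where
  "moebius_act A z = (of_real (A $ 1 $ 1) * z + of_real (A $ 1 $ 2)) /
                 (of_real (A $ 2 $ 1) * z + of_real (A $ 2 $ 2))"

text \<open>
  A hyperbolic structure on the oriented surface is an orientation preserving universal covering
  \<open>p\<close> by the upper half-plane whose deck transformations are Moebius transformations;
  \<open>j\<close> sends the class of a loop to the deck transformation taking the base point \<open>z\<^sub>0\<close> to the
  end of the lift of this loop starting at \<open>z\<^sub>0\<close>.
\<close>

definition hyperbolic_holonomy ::
    "'s::t2_space set \<Rightarrow> ('s set \<times> ('s \<Rightarrow> complex)) set \<Rightarrow> 's \<Rightarrow>
     ((real \<Rightarrow> 's) set \<Rightarrow> (real ^ 2 ^ 2) set) \<Rightarrow> bool" where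
  "hyperbolic_holonomy S \<A> s\<^sub>0 j \<longleftrightarrow>
     (let \<Gamma> = fundamental_group S s\<^sub>0 in
     j \<in> hom \<Gamma> PSL2 \<and> inj_on j (carrier \<Gamma>) \<and>
     subtopology PSL2_top (j ` carrier \<Gamma>) = discrete_topology (j ` carrier \<Gamma>) \<and>
     (\<exists>p z\<^sub>0. covering_space upper_half_plane p S \<and> z\<^sub>0 \<in> upper_half_plane \<and> p z\<^sub>0 = s\<^sub>0 \<and>
        (\<forall>(U, \<phi>)\<in>\<A>. \<forall>z\<in>upper_half_plane. p z \<in> U \<longrightarrow> orientation_preserving_at (\<phi> \<circ> p) z) \<and>
        (\<forall>\<gamma>\<in>carrier \<Gamma>. \<forall>A\<in>j \<gamma>.
           (\<forall>z\<in>upper_half_plane. p (moebius_act A z) = p z) \<and>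
           (\<exists>c. path c \<and> path_image c \<subseteq> upper_half_plane \<and> pathstart c = z\<^sub>0 \<and>
                pathfinish c = moebius_act A z\<^sub>0 \<and> p \<circ> c \<in> \<gamma>))))"

text \<open>
  The space of homomorphisms has the topology of pointwise convergence; its points are the
  homomorphisms that are \<open>undefined\<close> outside the carrier.
\<close>

definition hom_top :: "('g, 'x) monoid_scheme \<Rightarrow> ('g \<Rightarrow> 'n::finite mat2 set) topology" where
  "hom_top \<Gamma> = subtopology (product_topology (\<lambda>_. PSO_nn_top) (carrier \<Gamma>)) (hom \<Gamma> PSO_nn)"

definition conj_class ::
    "('g, 'x) monoid_scheme \<Rightarrow> ('g \<Rightarrow> 'n::finite mat2 set) \<Rightarrow> ('g \<Rightarrow> 'n mat2 set) set" where
  "conj_class \<Gamma> \<rho> =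
     {\<lambda>\<gamma>\<in>carrier \<Gamma>. h \<otimes>\<^bsub>PSO_nn\<^esub> \<rho> \<gamma> \<otimes>\<^bsub>PSO_nn\<^esub> inv\<^bsub>PSO_nn\<^esub> h | h. h \<in> carrier PSO_nn}"

definition character_space ::
    "('g, 'x) monoid_scheme \<Rightarrow> ('g \<Rightarrow> 'n::finite mat2 set) set topology" where
  "character_space \<Gamma> = quotient_top (hom_top \<Gamma>) (conj_class \<Gamma>)"

definition hitchin_representation ::
    "'s::t2_space set \<Rightarrow> ('s set \<times> ('s \<Rightarrow> complex)) set \<Rightarrow> 's \<Rightarrow>
     ((real ^ 2 ^ 2) set \<Rightarrow> 'n::finite mat2 set) \<Rightarrow> ((real \<Rightarrow> 's) set \<Rightarrow> 'n mat2 set) \<Rightarrow> bool" where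
  "hitchin_representation S \<A> s\<^sub>0 \<tau> \<rho> \<longleftrightarrow>
     (let \<Gamma> = fundamental_group S s\<^sub>0 in
     \<rho> \<in> hom \<Gamma> PSO_nn \<and>
     (\<exists>j. hyperbolic_holonomy S \<A> s\<^sub>0 j \<and>
        connected_component_of (character_space \<Gamma>) (conj_class \<Gamma> (\<tau> \<circ> j)) (conj_class \<Gamma> \<rho>)))"


section \<open>The Gromov boundary\<close>

definition word_length :: "('g, 'x) monoid_scheme \<Rightarrow> 'g set \<Rightarrow> 'g \<Rightarrow> nat" where
  "word_length G A g = (LEAST k. \<exists>ws. set ws \<subseteq> A \<union> (\<lambda>a. inv\<^bsub>G\<^esub> a) ` A \<and> length ws = k \<and>
     foldr (\<lambda>a h. a \<otimes>\<^bsub>G\<^esub> h) ws \<one>\<^bsub>G\<^esub> = g)"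

definition gromov_product :: "('g, 'x) monoid_scheme \<Rightarrow> 'g set \<Rightarrow> 'g \<Rightarrow> 'g \<Rightarrow> real" where
  "gromov_product G A g h =
     (real (word_length G A g) + real (word_length G A h)
       - real (word_length G A (inv\<^bsub>G\<^esub> g \<otimes>\<^bsub>G\<^esub> h))) / 2"

definition gromov_equivalent ::
    "('g, 'x) monoid_scheme \<Rightarrow> 'g set \<Rightarrow> (nat \<Rightarrow> 'g) \<Rightarrow> (nat \<Rightarrow> 'g) \<Rightarrow> bool" where
  "gromov_equivalent G A s t \<longleftrightarrow>
     filterlim (\<lambda>(i, k). gromov_product G A (s i) (t k)) at_top (sequentially \<times>\<^sub>F sequentially)"

text \<open>Sequences converging to infinity are the \<open>s\<close> with \<open>gromov_equivalent G A s s\<close>.\<close>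

definition gromov_boundary :: "('g, 'x) monoid_scheme \<Rightarrow> 'g set \<Rightarrow> (nat \<Rightarrow> 'g) set set" where
  "gromov_boundary G A =
     {{t \<in> UNIV \<rightarrow> carrier G. gromov_equivalent G A t t \<and> gromov_equivalent G A s t} | s.
        s \<in> UNIV \<rightarrow> carrier G \<and> gromov_equivalent G A s s}"

definition gromov_near ::
    "('g, 'x) monoid_scheme \<Rightarrow> 'g set \<Rightarrow> real \<Rightarrow> (nat \<Rightarrow> 'g) set \<Rightarrow> (nat \<Rightarrow> 'g) set \<Rightarrow> bool" where
  "gromov_near G A R x y \<longleftrightarrow> (\<exists>s\<in>x. \<exists>t\<in>y.
     \<forall>\<^sub>F (i, k) in sequentially \<times>\<^sub>F sequentially. gromov_product G A (s i) (t k) \<ge> R)"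

definition boundary_top :: "('g, 'x) monoid_scheme \<Rightarrow> 'g set \<Rightarrow> (nat \<Rightarrow> 'g) set topology" where
  "boundary_top G A = topology (\<lambda>U. U \<subseteq> gromov_boundary G A \<and>
     (\<forall>x\<in>U. \<exists>R. \<forall>y\<in>gromov_boundary G A. gromov_near G A R x y \<longrightarrow> y \<in> U))"

lemma gromov_near_mono: "gromov_near G A R x y \<Longrightarrow> R' \<le> R \<Longrightarrow> gromov_near G A R' x y"
  unfolding gromov_near_def by (elim bexE, intro bexI) (auto elim!: eventually_mono)

lemma openin_boundary_top:
  "openin (boundary_top G A) U \<longleftrightarrow> U \<subseteq> gromov_boundary G A \<and>
     (\<forall>x\<in>U. \<exists>R. \<forall>y\<in>gromov_boundary G A. gromov_near G A R x y \<longrightarrow> y \<in> U)"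
proof -
  have "istopology (\<lambda>U. U \<subseteq> gromov_boundary G A \<and>
     (\<forall>x\<in>U. \<exists>R. \<forall>y\<in>gromov_boundary G A. gromov_near G A R x y \<longrightarrow> y \<in> U))" (is "istopology ?P")
    unfolding istopology_def
  proof (intro conjI)
    show "\<forall>U V. ?P U \<longrightarrow> ?P V \<longrightarrow> ?P (U \<inter> V)"
    proof (intro allI impI conjI ballI)
      fix U V x assume *: "?P U" "?P V" and x: "x \<in> U \<inter> V"
      then obtain R R' where "\<forall>y\<in>gromov_boundary G A. gromov_near G A R x y \<longrightarrow> y \<in> U"
        and "\<forall>y\<in>gromov_boundary G A. gromov_near G A R' x y \<longrightarrow> y \<in> V" by blast
      then have "\<forall>y\<in>gromov_boundary G A. gromov_near G A (max R R') x y \<longrightarrow> y \<in> U \<inter> V"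
        by (meson IntI gromov_near_mono max.cobounded1 max.cobounded2)
      then show "\<exists>R. \<forall>y\<in>gromov_boundary G A. gromov_near G A R x y \<longrightarrow> y \<in> U \<inter> V" by blast
    qed blast
    show "\<forall>\<K>. (\<forall>K\<in>\<K>. ?P K) \<longrightarrow> ?P (\<Union>\<K>)"
      by (intro allI impI conjI ballI) (blast, meson UnionE UnionI)
  qed
  then show ?thesis by (simp add: boundary_top_def topology_inverse')
qed

lemma topspace_boundary_top: "topspace (boundary_top G A) = gromov_boundary G A"
proof
  show "topspace (boundary_top G A) \<subseteq> gromov_boundary G A"
    using openin_topspace openin_boundary_top by metis
  have "openin (boundary_top G A) (gromov_boundary G A)" by (simp add: openin_boundary_top)
  then show "gromov_boundary G A \<subseteq> topspace (boundary_top G A)" by (rule openin_subset)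
qed

definition boundary_act ::
    "('g, 'x) monoid_scheme \<Rightarrow> 'g \<Rightarrow> (nat \<Rightarrow> 'g) set \<Rightarrow> (nat \<Rightarrow> 'g) set" where
  "boundary_act G g x = (\<lambda>s k. g \<otimes>\<^bsub>G\<^esub> s k) ` x"


section \<open>Positive curves\<close>

text \<open>
  The orientation of the circle \<open>\<partial>\<Gamma>\<close> is recorded by a homeomorphism \<open>\<theta>\<close> onto the unit
  circle of the plane; triples are positively ordered if their images are met in this order
  when travelling counterclockwise.
\<close>

definition positively_ordered :: "('b \<Rightarrow> complex) \<Rightarrow> 'b \<Rightarrow> 'b \<Rightarrow> 'b \<Rightarrow> bool" where
  "positively_ordered \<theta> x y z \<longleftrightarrow>
     (\<exists>r s t. r < s \<and> s < t \<and> t < r + 2 * pi \<and> \<theta> x = cis r \<and> \<theta> y = cis s \<and> \<theta> z = cis t)"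

definition positive_curve ::
    "('g, 'x) monoid_scheme \<Rightarrow> 'g set \<Rightarrow> ((nat \<Rightarrow> 'g) set \<Rightarrow> complex) \<Rightarrow>
     ('g \<Rightarrow> 'n::finite mat2 set) \<Rightarrow> ((nat \<Rightarrow> 'g) set \<Rightarrow> 'n flag) \<Rightarrow> bool" where
  "positive_curve \<Gamma> A \<theta> \<rho> \<xi> \<longleftrightarrow>
     continuous_flag_map (boundary_top \<Gamma> A) \<xi> \<and>
     (\<forall>\<gamma>\<in>carrier \<Gamma>. \<forall>M\<in>\<rho> \<gamma>. \<forall>x\<in>gromov_boundary \<Gamma> A.
        \<xi> (boundary_act \<Gamma> \<gamma> x) = flag_image M (\<xi> x)) \<and>
     (\<forall>x\<in>gromov_boundary \<Gamma> A. \<forall>y\<in>gromov_boundary \<Gamma> A. \<forall>z\<in>gromov_boundary \<Gamma> A.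
        positively_ordered \<theta> x y z \<longrightarrow> positive_triple (\<xi> x) (\<xi> y) (\<xi> z))"

end

theory Submission
  imports Defs
begin

text \<open>
  The statement is one about positive triples of flags. A cyclic rotation of a positively ordered triple is
  positively ordered, so of two distinct points \<open>x\<close>, \<open>z\<close> different from \<open>y\<close>, one is the
  second and the other the third member of a positive triple whose first member is \<open>y\<close>.
  With \<open>b\<close> the pinning basis of that triple and $V_k = \langle b_1, \dots, b_k \rangle$, the flag
  of \<open>y\<close> is the flag of the $V_k$, and those of \<open>x\<close> and \<open>z\<close> are the opposite
  coordinate flag \<open>E\<close> and its image \<open>u E\<close> under a totally positive \<open>u\<close>, in one order or
  the other.

  Since \<open>u\<close> is unipotent and respects the $V_k$, the line that the flag of \<open>z\<close> cuts out in
  $V_{n+2}$ contains $b_{n+2}$ or $u b_{n+2}$, while the $(n-1)$-plane of \<open>x\<close> contains the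
  other of these two vectors. Everything thus rests on their difference, for which
  $$u b_{n+2} \equiv b_{n+2} - \alpha b_{n+1} - \beta b_n \pmod{V_{n-1}},$$
  where $\alpha$ and $\beta$ are the sums of the parameters of \<open>u\<close> at the letters \<open>n - 1\<close>
  and \<open>n\<close> (lemma \<open>root_word_middle\<close>). Both are positive, because neither of the two
  maximal parabolic subgroups omitting one of these letters contains the longest element of the
  Weyl group (lemma \<open>longest_word_letters\<close>). On the other hand, an isotropic n-plane
  containing $V_{n-1}$ contains $b_n$ or $b_{n+1}$ (lemma \<open>isotropic_contains_middle\<close>),
  and the difference then supplies the missing one. So the sum contains $V_{n+2}$, and the
  remaining basis vectors follow by unipotence (lemma \<open>sum_is_everything\<close>).
\<close>

declare One_nat_def [simp del]

section \<open>The form and pinning bases\<close>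

lemma linear_form_left: "linear (\<lambda>x. form x y)"
  by (rule linearI) (simp_all add: form_def algebra_simps sum.distrib sum_distrib_left)

lemma linear_form_right: "linear (form x)"
  by (rule linearI) (simp_all add: form_def algebra_simps sum.distrib sum_distrib_left)

lemmas form_simps =
  linear_add[OF linear_form_left] linear_add[OF linear_form_right]
  linear_cmul[OF linear_form_left] linear_cmul[OF linear_form_right]
  linear_diff[OF linear_form_left] linear_diff[OF linear_form_right]
  linear_0[OF linear_form_left] linear_0[OF linear_form_right]
  linear_sum[OF linear_form_left] linear_sum[OF linear_form_right]

lemma form_zero_on_span:
  assumes "w \<in> span B" "\<And>v. v \<in> B \<Longrightarrow> form x v = 0"
  shows "form x w = 0"
  using linear_eq_0_on_span[OF linear_form_right[of x] assms(2) assms(1)] by simp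

lemma linear_root_vector: "linear (root_vector b \<mu> i)"
  by (rule linearI) (simp_all add: root_vector_def Let_def form_simps algebra_simps)

context
  fixes b :: "nat \<Rightarrow> 'n::finite vec2" and \<mu> :: real and n :: nat
  assumes pin: "pinning_basis b \<mu>" and n_def: "n = CARD('n)" and n2: "n \<ge> 2"
begin

lemma mu_square: "\<mu> * \<mu> = 1"
  using pin unfolding pinning_basis_def by auto

lemma form_basis:
  assumes "i \<in> {1..2 * n}" "j \<in> {1..2 * n}"
  shows "form (b i) (b j) = (if i + j = 2 * n + 1 then \<mu> else 0)"
  using pin assms unfolding pinning_basis_def n_def by blast

lemma form_dual_basis:
  assumes "i \<in> {1..2 * n}" "j \<in> {1..2 * n}"
  shows "form (b i) (b (2 * n + 1 - j)) = (if i = j then \<mu> else 0)"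
proof -
  have "2 * n + 1 - j \<in> {1..2 * n}" "i + (2 * n + 1 - j) = 2 * n + 1 \<longleftrightarrow> i = j"
    using assms unfolding atLeastAtMost_iff by arith+
  then show ?thesis using assms(1) by (simp only: form_basis)
qed

lemma pinning_basis_inj: "inj_on b {1..2 * n}"
proof (rule inj_onI)
  fix i j assume ij: "i \<in> {1..2 * n}" "j \<in> {1..2 * n}" "b i = b j"
  then have "form (b j) (b (2 * n + 1 - i)) = \<mu>"
    using form_dual_basis[of i i] by simp
  then have "(if j = i then \<mu> else 0) = \<mu>" using form_dual_basis[OF ij(2,1)] by argo
  then show "i = j" using mu_square by (cases "j = i") auto
qed

lemma pinning_basis_independent: "independent (b ` {1..2 * n})"
proof (rule independent_if_scalars_zero)
  fix f x assume sum0: "(\<Sum>x\<in>b ` {1..2 * n}. f x *\<^sub>R x) = 0" and "x \<in> b ` {1..2 * n}"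
  then obtain j where j: "j \<in> {1..2 * n}" "x = b j" by blast
  have "(\<Sum>i\<in>{1..2 * n}. f (b i) *\<^sub>R b i) = 0"
    using sum0 by (simp add: sum.reindex[OF pinning_basis_inj])
  then have "0 = form (\<Sum>i\<in>{1..2 * n}. f (b i) *\<^sub>R b i) (b (2 * n + 1 - j))"
    by (simp add: linear_0[OF linear_form_left])
  also have "\<dots> = (\<Sum>i\<in>{1..2 * n}. if i = j then f (b i) * \<mu> else 0)"
    unfolding form_simps using j(1) by (intro sum.cong) (auto simp: form_dual_basis)
  also have "\<dots> = f x * \<mu>" using j by simp
  finally show "f x = 0" using mu_square by auto
qed simp

lemma pinning_basis_spans: "span (b ` {1..2 * n}) = UNIV"
proof -
  have "dim (UNIV :: 'n vec2 set) \<le> card (b ` {1..2 * n})"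
    unfolding card_image[OF pinning_basis_inj] by (simp add: n_def)
  then show ?thesis
    using card_ge_dim_independent[OF _ pinning_basis_independent, of UNIV] by auto
qed

lemma pinning_expansion: "v = (\<Sum>j\<in>{1..2 * n}. (\<mu> * form v (b (2 * n + 1 - j))) *\<^sub>R b j)"
proof -
  let ?g = "\<lambda>v. \<Sum>j\<in>{1..2 * n}. (\<mu> * form v (b (2 * n + 1 - j))) *\<^sub>R b j"
  have lin: "linear ?g"
    by (rule linearI) (simp_all add: form_simps algebra_simps sum.distrib scaleR_sum_right)
  have "id v = ?g v"
  proof (rule linear_eq_on_span[OF linear_id lin])
    fix x assume "x \<in> b ` {1..2 * n}"
    then obtain i where i: "i \<in> {1..2 * n}" "x = b i" by blast
    have "?g x = (\<Sum>j\<in>{1..2 * n}. if j = i then b j else 0)"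
      using i by (intro sum.cong) (auto simp: form_dual_basis mu_square)
    then show "id x = ?g x" using i by simp
  qed (simp add: pinning_basis_spans)
  then show ?thesis by simp
qed

abbreviation V :: "nat \<Rightarrow> 'n vec2 set" where
  "V k \<equiv> span (b ` {1..k})"

lemma V_mono: "j \<le> k \<Longrightarrow> V j \<subseteq> V k"
  by (intro span_mono image_mono) auto

lemma basis_in_V: "1 \<le> j \<Longrightarrow> j \<le> k \<Longrightarrow> b j \<in> V k"
  by (intro span_base) auto

text \<open>
  The form induced on $V_{n-1}^\perp / V_{n-1}$ is that of a hyperbolic plane, whose only
  isotropic lines are those of $b_n$ and $b_{n+1}$.
\<close>

lemma isotropic_contains_middle:
  assumes H: "isotropic_plane n H" and VH: "V (n - 1) \<subseteq> H"
  shows "b n \<in> H \<or> b (n + 1) \<in> H"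
proof -
  have sub: "subspace H" and dimH: "dim H = n" and iso: "\<And>v w. v \<in> H \<Longrightarrow> w \<in> H \<Longrightarrow> form v w = 0"
    using H unfolding isotropic_plane_def by auto
  have "dim (V (n - 1)) \<le> n - 1"
    using dim_le_card[of "V (n - 1)" "b ` {1..n - 1}"] card_image_le[of "{1..n - 1}" b] by simp
  then have "\<not> H \<subseteq> V (n - 1)"
    using dim_subset[of H "V (n - 1)"] dimH n2 by auto
  then obtain h where h: "h \<in> H" "h \<notin> V (n - 1)" by blast
  define c where "c j = \<mu> * form h (b (2 * n + 1 - j))" for j
  define r where "r = (\<Sum>j\<in>{1..n - 1}. c j *\<^sub>R b j)"
  have r: "r \<in> V (n - 1)"
    unfolding r_def by (intro span_sum span_scale basis_in_V) auto
  have "c j = 0" if "j \<in> {n + 2..2 * n}" for j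
  proof -
    have "b (2 * n + 1 - j) \<in> H" using that VH basis_in_V[of "2 * n + 1 - j" "n - 1"] by auto
    then show ?thesis using iso[OF h(1)] by (simp add: c_def)
  qed
  then have tail: "(\<Sum>j\<in>{n + 2..2 * n}. c j *\<^sub>R b j) = 0" by simp
  have split: "{1..2 * n} = {1..n - 1} \<union> ({n, n + 1} \<union> {n + 2..2 * n})" using n2 by auto
  have "h = (\<Sum>j\<in>{1..2 * n}. c j *\<^sub>R b j)" using pinning_expansion[of h] by (simp add: c_def)
  also have "\<dots> = r + ((\<Sum>j\<in>{n, n + 1}. c j *\<^sub>R b j) + (\<Sum>j\<in>{n + 2..2 * n}. c j *\<^sub>R b j))"
    unfolding split r_def
    using n2 by (subst sum.union_disjoint, force, force, force)
      (subst sum.union_disjoint, auto)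
  finally have h_eq: "h = r + (c n *\<^sub>R b n + c (n + 1) *\<^sub>R b (n + 1))" using tail by simp
  have "form h r = 0" using iso[OF h(1)] r VH by blast
  then have "c n * form h (b n) + c (n + 1) * form h (b (n + 1)) = form h h"
    by (subst (4) h_eq) (simp add: form_simps)
  also have "\<dots> = 0" using iso h by blast
  finally have "2 * \<mu> * (form h (b n) * form h (b (n + 1))) = 0"
    by (simp add: c_def algebra_simps)
  then have zero: "c n = 0 \<or> c (n + 1) = 0" using mu_square by (auto simp: c_def)
  have rest: "h - r \<in> H" using sub h(1) r VH by (auto intro: subspace_diff)
  have "h \<noteq> r" using h(2) r by blast
  show ?thesis
  proof (cases "c n = 0")
    case True
    then have "(1 / c (n + 1)) *\<^sub>R (h - r) = b (n + 1)" using h_eq \<open>h \<noteq> r\<close> by auto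
    then show ?thesis using subspace_scale[OF sub rest] by metis
  next
    case False
    then have "(1 / c n) *\<^sub>R (h - r) = b n" using h_eq zero by auto
    then show ?thesis using subspace_scale[OF sub rest] by metis
  qed
qed

section \<open>Products of root group elements\<close>

lemma root_vector_basis:
  assumes i: "i \<in> {1..n}" and j: "j \<in> {1..2 * n}"
  shows "root_vector b \<mu> i (b j) =
    (if i < n then (if j = i + 1 then b i else 0) - (if j = 2 * n + 1 - i then b (2 * n - i) else 0)
     else (if j = n + 1 then b (n - 1) else 0) - (if j = n + 2 then b n else 0))"
proof (cases "i < n")
  case True
  then have "2 * n - i \<in> {1..2 * n}" "j + (2 * n - i) = 2 * n + 1 \<longleftrightarrow> j = i + 1"
    "i \<in> {1..2 * n}" "j + i = 2 * n + 1 \<longleftrightarrow> j = 2 * n + 1 - i"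
    using i j n2 unfolding atLeastAtMost_iff by arith+
  then have "form (b j) (b (2 * n - i)) = (if j = i + 1 then \<mu> else 0)"
    "form (b j) (b i) = (if j = 2 * n + 1 - i then \<mu> else 0)"
    using j by (simp_all only: form_basis)
  then show ?thesis
    using True unfolding root_vector_def Let_def n_def[symmetric]
    by (simp add: scaleR_diff_right mu_square)
next
  case False
  then have "n \<in> {1..2 * n}" "j + n = 2 * n + 1 \<longleftrightarrow> j = n + 1"
    "n - 1 \<in> {1..2 * n}" "j + (n - 1) = 2 * n + 1 \<longleftrightarrow> j = n + 2"
    using i j n2 unfolding atLeastAtMost_iff by arith+
  then have "form (b j) (b n) = (if j = n + 1 then \<mu> else 0)"
    "form (b j) (b (n - 1)) = (if j = n + 2 then \<mu> else 0)"
    using j by (simp_all only: form_basis)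
  then show ?thesis
    using False unfolding root_vector_def Let_def n_def[symmetric]
    by (simp add: scaleR_diff_right mu_square)
qed

lemma root_vector_lowers:
  assumes i: "i \<in> {1..n}" and j: "j \<in> {1..2 * n}"
  shows "root_vector b \<mu> i (b j) \<in> V (j - 1)"
  unfolding root_vector_basis[OF i j] using i j n2
  by (auto intro!: span_diff span_0 span_neg basis_in_V)

lemma root_vector_middle:
  assumes i: "i \<in> {1..n}"
  shows "root_vector b \<mu> i (b n) \<in> V (n - 1)" "root_vector b \<mu> i (b (n + 1)) \<in> V (n - 1)"
  using i n2 by (auto simp: root_vector_basis intro!: span_diff span_0 span_neg basis_in_V)

lemma root_vector_V:
  assumes i: "i \<in> {1..n}" and k: "k \<le> 2 * n" and v: "v \<in> V k"
  shows "root_vector b \<mu> i v \<in> V (k - 1)"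
proof -
  have "root_vector b \<mu> i ` V k \<subseteq> V (k - 1)"
    unfolding linear_span_image[OF linear_root_vector, symmetric]
  proof (intro span_minimal subspace_span, clarify)
    fix j assume "j \<in> {1..k}"
    then show "root_vector b \<mu> i (b j) \<in> V (k - 1)"
      using root_vector_lowers[OF i, of j] V_mono[of "j - 1" "k - 1"] k by fastforce
  qed
  then show ?thesis using v by blast
qed

definition root_word :: "(nat \<times> real) list \<Rightarrow> 'n vec2 \<Rightarrow> 'n vec2" where
  "root_word ps = foldr (\<lambda>(i, a) u. root_group b \<mu> i a \<circ> u) ps id"

definition letter_weight :: "nat \<Rightarrow> (nat \<times> real) list \<Rightarrow> real" where
  "letter_weight i ps = (\<Sum>p\<leftarrow>ps. if fst p = i then snd p else 0)"

lemma root_word_Nil: "root_word [] = id"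
  by (simp add: root_word_def)

lemma root_word_Cons:
  "root_word ((i, a) # ps) v = root_word ps v + a *\<^sub>R root_vector b \<mu> i (root_word ps v)"
  by (simp add: root_word_def root_group_def)

lemma root_word_unipotent:
  assumes "fst ` set ps \<subseteq> {1..n}" and j: "j \<in> {1..2 * n}"
  shows "root_word ps (b j) - b j \<in> V (j - 1)"
  using assms(1)
proof (induction ps)
  case Nil
  then show ?case by (simp add: root_word_Nil span_0)
next
  case (Cons p ps)
  obtain i a where p: "p = (i, a)" by force
  have i: "i \<in> {1..n}" and IH: "root_word ps (b j) - b j \<in> V (j - 1)"
    using Cons p by auto
  have "(root_word ps (b j) - b j) + b j \<in> V j"
    using IH V_mono[of "j - 1" j] j by (intro span_add basis_in_V) auto
  then have "root_vector b \<mu> i (root_word ps (b j)) \<in> V (j - 1)"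
    using root_vector_V[OF i, of j] j by simp
  then have "(root_word ps (b j) - b j) + a *\<^sub>R root_vector b \<mu> i (root_word ps (b j)) \<in> V (j - 1)"
    using IH by (intro span_add span_scale)
  then show ?case by (simp add: p root_word_Cons algebra_simps)
qed

text \<open>
  Modulo $V_{n-1}$, the root vectors kill $b_n$ and $b_{n+1}$ and move $b_{n+2}$ into their span,
  so the parameters of a product of root group elements simply add up.
\<close>

lemma root_word_middle:
  assumes "fst ` set ps \<subseteq> {1..n}"
  shows "root_word ps (b (n + 2)) - b (n + 2)
      + letter_weight (n - 1) ps *\<^sub>R b (n + 1) + letter_weight n ps *\<^sub>R b n \<in> V (n - 1)"
  using assms
proof (induction ps)
  case Nil
  then show ?case by (simp add: root_word_Nil span_0 letter_weight_def)
next
  case (Cons p ps)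
  obtain i a where p: "p = (i, a)" by force
  define N where "N = root_vector b \<mu> i"
  define \<alpha> where "\<alpha> = letter_weight (n - 1) ps"
  define \<beta> where "\<beta> = letter_weight n ps"
  define r where "r = root_word ps (b (n + 2)) - b (n + 2) + \<alpha> *\<^sub>R b (n + 1) + \<beta> *\<^sub>R b n"
  have i: "i \<in> {1..n}" using Cons p by auto
  have r: "r \<in> V (n - 1)" using Cons unfolding r_def \<alpha>_def \<beta>_def by auto
  have word: "root_word ps (b (n + 2)) = b (n + 2) - \<alpha> *\<^sub>R b (n + 1) - \<beta> *\<^sub>R b n + r"
    by (simp add: r_def)
  have "N r \<in> V (n - 1)"
    using root_vector_V[OF i _ r] V_mono[of "n - 1 - 1" "n - 1"] unfolding N_def by fastforce
  then have rest: "a *\<^sub>R (N r - \<alpha> *\<^sub>R N (b (n + 1)) - \<beta> *\<^sub>R N (b n)) + r \<in> V (n - 1)"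
    using root_vector_middle[OF i] r unfolding N_def
    by (intro span_add span_scale span_diff)
  have N_top: "N (b (n + 2)) =
      - (if i = n - 1 then b (n + 1) else 0) - (if i = n then b n else 0)"
    using i n2 by (auto simp: N_def root_vector_basis)
  have weights: "letter_weight (n - 1) (p # ps) = (if i = n - 1 then a else 0) + \<alpha>"
      "letter_weight n (p # ps) = (if i = n then a else 0) + \<beta>"
    by (simp_all add: letter_weight_def p \<alpha>_def \<beta>_def)
  have N_word: "N (root_word ps (b (n + 2))) =
      N (b (n + 2)) + (N r - \<alpha> *\<^sub>R N (b (n + 1)) - \<beta> *\<^sub>R N (b n))"
    unfolding word N_def
    by (simp add: linear_add[OF linear_root_vector] linear_diff[OF linear_root_vector]
        linear_cmul[OF linear_root_vector])
  have "root_word (p # ps) (b (n + 2)) - b (n + 2)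
      + letter_weight (n - 1) (p # ps) *\<^sub>R b (n + 1) + letter_weight n (p # ps) *\<^sub>R b n
    = a *\<^sub>R (N r - \<alpha> *\<^sub>R N (b (n + 1)) - \<beta> *\<^sub>R N (b n)) + r"
    unfolding p root_word_Cons N_def[symmetric] N_word weights[unfolded p] N_top
    by (simp add: r_def algebra_simps)
  then show ?case using rest by simp
qed

section \<open>Letters of longest words\<close>

lemma weyl_word_preserves:
  assumes "\<And>i. i \<in> set is \<Longrightarrow> simple_reflection n i ` T \<subseteq> T"
  shows "weyl_word n is ` T \<subseteq> T"
  using assms by (induction "is") (auto simp: weyl_word_def)

text \<open>
  The simple reflections other than the last one preserve \<open>{1..n}\<close>, and exchanging \<open>n\<close> and
  \<open>n + 1\<close> shows that those other than the last but one preserve \<open>{1, \<dots>, n - 1, n + 1}\<close>.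
  The longest element preserves neither set, as it sends 1 to \<open>2n\<close>.
\<close>

lemma longest_word_letters:
  assumes "longest_word n is"
  shows "n - 1 \<in> set is" "n \<in> set is"
proof -
  have letters: "set is \<subseteq> {1..n}" and one: "weyl_word n is 1 = 2 * n"
    using assms n2 by (auto simp: longest_word_def reduced_word_def)
  have refl1: "simple_reflection n i ` insert (n + 1) {1..n - 1} \<subseteq> insert (n + 1) {1..n - 1}"
    if i: "i \<in> {1..n}" "i \<noteq> n - 1" for i
  proof (rule image_subsetI)
    fix k assume k: "k \<in> insert (n + 1) {1..n - 1}"
    show "simple_reflection n i k \<in> insert (n + 1) {1..n - 1}"
    proof (cases "i < n")
      case True
      then have "k \<noteq> 2 * n - i" "k \<noteq> 2 * n + 1 - i" "n + 1 \<noteq> i"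
        "n + 1 \<noteq> i + 1" "i \<le> n - 1" "i + 1 \<le> n - 1"
        using i k by auto
      then show ?thesis
        using True i(1) k by (auto simp: simple_reflection_def Transposition.transpose_def)
    next
      case False
      then have "k \<noteq> n" "k \<noteq> n + 2" "i = n" "1 \<le> n - 1" using i k n2 by auto
      then show ?thesis
        using k by (auto simp: simple_reflection_def Transposition.transpose_def)
    qed
  qed
  have refl2: "simple_reflection n i ` {1..n} \<subseteq> {1..n}" if "i \<in> {1..n}" "i \<noteq> n" for i
  proof (rule image_subsetI)
    fix k assume k: "k \<in> {1..n}"
    then have "k \<noteq> 2 * n - i" "k \<noteq> 2 * n + 1 - i" "i < n" using that by auto
    then show "simple_reflection n i k \<in> {1..n}"
      using that k by (auto simp: simple_reflection_def Transposition.transpose_def)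
  qed
  show "n - 1 \<in> set is"
  proof (rule ccontr)
    assume no: "n - 1 \<notin> set is"
    have "weyl_word n is ` insert (n + 1) {1..n - 1} \<subseteq> insert (n + 1) {1..n - 1}"
      by (rule weyl_word_preserves, rule refl1) (use letters no in auto)
    moreover have "1 \<in> insert (n + 1) {1..n - 1}" using n2 by simp
    ultimately have "2 * n \<in> insert (n + 1) {1..n - 1}" using one by (metis image_subset_iff)
    then show False using n2 by auto
  qed
  show "n \<in> set is"
  proof (rule ccontr)
    assume no: "n \<notin> set is"
    have "weyl_word n is ` {1..n} \<subseteq> {1..n}"
      by (rule weyl_word_preserves, rule refl2) (use letters no in auto)
    moreover have "1 \<in> {1..n}" using n2 by simp
    ultimately have "2 * n \<in> {1..n}" using one by (metis image_subset_iff)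
    then show False using n2 by auto
  qed
qed

lemma letter_weight_pos:
  assumes "\<And>p. p \<in> set ps \<Longrightarrow> snd p > 0" "i \<in> fst ` set ps"
  shows "letter_weight i ps > 0"
proof -
  have "letter_weight i qs \<ge> 0" if "\<And>p. p \<in> set qs \<Longrightarrow> snd p > 0" for qs
    unfolding letter_weight_def using that by (intro sum_list_nonneg) (auto intro: less_imp_le)
  note nonneg = this
  obtain xs p ys where ps: "ps = xs @ p # ys" and p: "fst p = i"
    using assms(2) split_list by (metis imageE)
  have "letter_weight i ps = letter_weight i xs + (snd p + letter_weight i ys)"
    by (simp add: letter_weight_def ps p)
  moreover have "letter_weight i xs \<ge> 0" "letter_weight i ys \<ge> 0" "snd p > 0"
    using nonneg[of xs] nonneg[of ys] assms(1) unfolding ps by simp_all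
  ultimately show ?thesis by linarith
qed

lemma totally_positive_action:
  assumes "u \<in> totally_positive b \<mu>"
  obtains \<alpha> \<beta> where "\<And>j. j \<in> {1..2 * n} \<Longrightarrow> u (b j) - b j \<in> V (j - 1)"
    "\<alpha> > 0" "\<beta> > 0"
    "u (b (n + 2)) - b (n + 2) + \<alpha> *\<^sub>R b (n + 1) + \<beta> *\<^sub>R b n \<in> V (n - 1)"
proof -
  obtain "is" as where u: "u = root_word (zip is as)" and word: "longest_word n is"
    and len: "length as = length is" and pos: "\<And>a. a \<in> set as \<Longrightarrow> a > 0"
    using assms unfolding totally_positive_def root_word_def n_def[symmetric] by blast
  have fst_zip: "fst ` set (zip is as) = set is"
    using len by (metis list.set_map map_fst_zip)
  have letters: "fst ` set (zip is as) \<subseteq> {1..n}"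
    using word by (auto simp: fst_zip longest_word_def reduced_word_def)
  have pos': "snd p > 0" if "p \<in> set (zip is as)" for p
    using that pos by (metis prod.collapse set_zip_rightD)
  have "letter_weight (n - 1) (zip is as) > 0" "letter_weight n (zip is as) > 0"
    using letter_weight_pos pos' longest_word_letters[OF word] unfolding fst_zip[symmetric]
    by blast+
  then show thesis
    using that root_word_unipotent[OF letters] root_word_middle[OF letters]
    unfolding u by blast
qed

section \<open>The sum of subspaces\<close>

text \<open>
  The difference of $b_{n+2}$ and $u b_{n+2}$ puts $\alpha b_{n+1} + \beta b_n$ into \<open>S\<close>, and
  \<open>H\<close> contributes one of these two basis vectors; as both coefficients are nonzero, \<open>S\<close>
  contains the other one too. Beyond index \<open>n + 2\<close>, the vectors $b_j$ and $u b_j$ are equivalent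
  modulo $V_{j-1}$, so it does not matter which of the two families \<open>S\<close> contains.
\<close>

lemma sum_is_everything:
  assumes u: "u \<in> totally_positive b \<mu>"
    and S: "subspace S" and H: "isotropic_plane n H" "V (n - 1) \<subseteq> H" "H \<subseteq> S"
    and both: "b (n + 2) \<in> S" "u (b (n + 2)) \<in> S"
    and rest: "(\<forall>j\<in>{n + 2..2 * n}. b j \<in> S) \<or> (\<forall>j\<in>{n + 2..2 * n}. u (b j) \<in> S)"
  shows "S = UNIV"
proof -
  obtain \<alpha> \<beta> where unip: "\<And>j. j \<in> {1..2 * n} \<Longrightarrow> u (b j) - b j \<in> V (j - 1)"
    and ab: "\<alpha> > 0" "\<beta> > 0"
    and mid: "u (b (n + 2)) - b (n + 2) + \<alpha> *\<^sub>R b (n + 1) + \<beta> *\<^sub>R b n \<in> V (n - 1)"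
    using totally_positive_action[OF u] by blast
  have "(u (b (n + 2)) - b (n + 2) + \<alpha> *\<^sub>R b (n + 1) + \<beta> *\<^sub>R b n)
      - (u (b (n + 2)) - b (n + 2)) \<in> S"
    using mid H both by (intro subspace_diff[OF S]) auto
  then have comb: "\<alpha> *\<^sub>R b (n + 1) + \<beta> *\<^sub>R b n \<in> S" by (simp add: algebra_simps)
  have "b n \<in> S \<and> b (n + 1) \<in> S"
    using isotropic_contains_middle[OF H(1,2)]
  proof
    assume "b n \<in> H"
    then have bn: "b n \<in> S" using H by blast
    then have "(1 / \<alpha>) *\<^sub>R ((\<alpha> *\<^sub>R b (n + 1) + \<beta> *\<^sub>R b n) - \<beta> *\<^sub>R b n) \<in> S"
      using comb by (intro subspace_scale[OF S] subspace_diff[OF S])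
    then show ?thesis using bn ab by simp
  next
    assume "b (n + 1) \<in> H"
    then have bn: "b (n + 1) \<in> S" using H by blast
    then have "(1 / \<beta>) *\<^sub>R ((\<alpha> *\<^sub>R b (n + 1) + \<beta> *\<^sub>R b n) - \<alpha> *\<^sub>R b (n + 1)) \<in> S"
      using comb by (intro subspace_scale[OF S] subspace_diff[OF S])
    then show ?thesis using bn ab by simp
  qed
  have all: "b j \<in> S" if "j \<in> {1..2 * n}" for j
    using that
  proof (induction j rule: less_induct)
    case (less j)
    consider "j \<le> n - 1" | "j = n" | "j = n + 1" | "j \<in> {n + 2..2 * n}"
      using less.prems by force
    then show ?case
    proof cases
      case 1
      then have "b j \<in> V (n - 1)" using less.prems by (intro basis_in_V) auto
      then show ?thesis using H by blast
    next
      case 4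
      have "V (j - 1) \<subseteq> S"
        using less by (intro span_minimal S) auto
      then have diff: "u (b j) - b j \<in> S" using unip[OF less.prems] by blast
      from rest show ?thesis
      proof
        assume "\<forall>j\<in>{n + 2..2 * n}. u (b j) \<in> S"
        then have "u (b j) - (u (b j) - b j) \<in> S"
          using 4 by (intro subspace_diff[OF S _ diff]) auto
        then show ?thesis by simp
      qed (use 4 in blast)
    qed (use \<open>b n \<in> S \<and> b (n + 1) \<in> S\<close> in auto)
  qed
  have "span (b ` {1..2 * n}) \<subseteq> S"
    using all by (intro span_minimal S) auto
  then show ?thesis using pinning_basis_spans by auto
qed

lemma V_subset_perp: "V (n + 2) \<subseteq> perp (V (n - 2))"
proof -
  have "form v w = 0" if v: "v \<in> V (n - 2)" and w: "w \<in> V (n + 2)" for v w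
  proof (rule form_zero_on_span[OF w])
    fix x assume "x \<in> b ` {1..n + 2}"
    then obtain j where j: "j \<in> {1..n + 2}" "x = b j" by blast
    have "form y x = 0" if "y \<in> b ` {1..n - 2}" for y
      using that j n2 by (auto simp: form_basis)
    then show "form v x = 0"
      using linear_eq_0_on_span[OF linear_form_left[of x] _ v] by blast
  qed
  then show ?thesis by (auto simp: perp_def)
qed

end


lemma subspace_set_plus:
  assumes "subspace S" "subspace T"
  shows "subspace (S + T)"
proof -
  have "S + T = {x + y | x y. x \<in> S \<and> y \<in> T}" by (auto simp: set_plus_def)
  then show ?thesis using subspace_sums[OF assms] by simp
qed

lemma subset_set_plus:
  assumes "subspace S" "subspace T"
  shows "S \<subseteq> S + T" "T \<subseteq> S + T"
  using set_plus_intro[OF _ subspace_0[OF assms(2)]] set_plus_intro[OF subspace_0[OF assms(1)]]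
  by auto

lemma subspace_perp: "subspace (perp W)"
  unfolding subspace_def perp_def by (simp add: form_simps)

text \<open>
  In either order of the last two flags of the triple, one of the vectors $b_{n+2}$ and
  $u b_{n+2}$ lies in the (n-1)-plane of \<open>X\<close> and the other in the intersection of that of
  \<open>Z\<close> with $V_{n+2}$.
\<close>

lemma positive_triple_sum:
  fixes Y X Z :: "'n::finite flag"
  assumes n_def: "n = CARD('n)" and n2: "n \<ge> 2"
    and pos: "positive_triple Y Z X \<or> positive_triple Y X Z"
    and H: "isotropic_plane n H" "fsub Y (n - 1) \<subseteq> H"
  shows "fsub X (n - 1) + (fsub Z (n - 1) \<inter> fsub Y (n + 2)) + H = UNIV"
proof -
  define P where "P = fsub X (n - 1)"
  define Q where "Q = fsub Z (n - 1) \<inter> fsub Y (n + 2)"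
  have flag: "Y \<in> flags" "X \<in> flags" "Z \<in> flags" using pos by (auto simp: positive_triple_def)
  have sub: "subspace (fsub X (n - 1))" "subspace (fsub Z (n - 1))"
    using flag n2 by (auto simp: flags_def n_def isotropic_plane_def)
  have top: "fsub Y (n + 2) = perp (fsub Y (n - 2))"
  proof -
    have "\<forall>k<n. fsub Y (2 * n - k) = perp (fsub Y k)" using flag by (simp add: flags_def n_def)
    moreover have "2 * n - (n - 2) = n + 2" using n2 by simp
    ultimately show ?thesis using n2 by (metis diff_less zero_less_numeral pos2 less_le_trans)
  qed
  have subP: "subspace P" and subQ: "subspace Q" and subH: "subspace H"
    using sub H(1) subspace_perp[of "fsub Y (n - 2)"] unfolding P_def Q_def top
    by (simp_all add: isotropic_plane_def subspace_inter)
  have subS: "subspace (P + Q + H)"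
    using subP subQ subH by (intro subspace_set_plus)
  have P: "P \<subseteq> P + Q + H" and Q: "Q \<subseteq> P + Q + H" and HS: "H \<subseteq> P + Q + H"
    using subset_set_plus[OF subP subQ] subset_set_plus[OF subspace_set_plus[OF subP subQ] subH]
    by blast+
  have pinned: "\<exists>b \<mu>. \<exists>u\<in>totally_positive b \<mu>. pinning_basis b \<mu> \<and>
      (\<forall>k<n. fsub Y k = span (b ` {1..k})) \<and>
      fsub G (n - 1) = span (b ` {n + 2..2 * n}) \<and> fsub F (n - 1) = u ` fsub G (n - 1)"
    if pt: "positive_triple Y F G" for F G
  proof -
    obtain b \<mu> u where u: "u \<in> totally_positive b \<mu>" and pin: "pinning_basis b \<mu>"
      and eqs: "\<forall>k<n. fsub Y k = span (b ` {1..k}) \<and>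
        fsub G k = span (b ` {2 * n + 1 - k..2 * n}) \<and> fsub F k = u ` fsub G k"
      using pt unfolding positive_triple_def n_def[symmetric] by blast
    have "2 * n + 1 - (n - 1) = n + 2" "n - 1 < n" using n2 by auto
    then have "fsub G (n - 1) = span (b ` {n + 2..2 * n})" "fsub F (n - 1) = u ` fsub G (n - 1)"
      using eqs by metis+
    then show ?thesis using u pin eqs by blast
  qed
  from pos have "P + Q + H = UNIV"
  proof
    assume "positive_triple Y Z X"
    from pinned[OF this] obtain b \<mu> u where u: "u \<in> totally_positive b \<mu>"
      and pin: "pinning_basis b \<mu>"
      and Y: "\<forall>k<n. fsub Y k = span (b ` {1..k})"
      and X: "fsub X (n - 1) = span (b ` {n + 2..2 * n})"
      and Z: "fsub Z (n - 1) = u ` fsub X (n - 1)" by blast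
    note in_V = basis_in_V[OF pin n_def n2]
    have bP: "b j \<in> P" if "j \<in> {n + 2..2 * n}" for j
      using that unfolding P_def X by (intro span_base) auto
    have "u (b j) - b j \<in> span (b ` {1..j - 1})" if "j \<in> {1..2 * n}" for j
      by (rule totally_positive_action[OF pin n_def n2 u]) (use that in blast)
    from this[of "n + 2"] have "u (b (n + 2)) - b (n + 2) \<in> span (b ` {1..Suc n})"
      using n2 by simp
    then have "(u (b (n + 2)) - b (n + 2)) + b (n + 2) \<in> span (b ` {1..n + 2})"
      using V_mono[OF pin n_def n2, of "Suc n" "n + 2"] by (intro span_add in_V) auto
    then have "u (b (n + 2)) \<in> fsub Y (n + 2)"
      using V_subset_perp[OF pin n_def n2] Y n2 unfolding top by auto
    moreover have "u (b (n + 2)) \<in> fsub Z (n - 1)"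
      using bP[of "n + 2"] n2 unfolding Z P_def by auto
    ultimately have "u (b (n + 2)) \<in> Q" by (simp add: Q_def)
    then have "b (n + 2) \<in> P + Q + H" "u (b (n + 2)) \<in> P + Q + H"
      "\<forall>j\<in>{n + 2..2 * n}. b j \<in> P + Q + H"
      using bP[of "n + 2"] bP P Q n2 by auto
    moreover have "span (b ` {1..n - 1}) \<subseteq> H" using H(2) Y n2 by simp
    ultimately show ?thesis
      using HS sum_is_everything[OF pin n_def n2 u subS H(1)] by blast
  next
    assume "positive_triple Y X Z"
    from pinned[OF this] obtain b \<mu> u where u: "u \<in> totally_positive b \<mu>"
      and pin: "pinning_basis b \<mu>"
      and Y: "\<forall>k<n. fsub Y k = span (b ` {1..k})"
      and Z: "fsub Z (n - 1) = span (b ` {n + 2..2 * n})"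
      and X: "fsub X (n - 1) = u ` fsub Z (n - 1)" by blast
    have bZ: "b j \<in> fsub Z (n - 1)" if "j \<in> {n + 2..2 * n}" for j
      using that unfolding Z by (intro span_base) auto
    then have uP: "u (b j) \<in> P" if "j \<in> {n + 2..2 * n}" for j
      using that unfolding P_def X by blast
    have "b (n + 2) \<in> span (b ` {1..n + 2})"
      by (intro basis_in_V[OF pin n_def n2]) auto
    then have "b (n + 2) \<in> Q"
      using V_subset_perp[OF pin n_def n2] Y n2 bZ[of "n + 2"] unfolding Q_def top by auto
    then have "b (n + 2) \<in> P + Q + H" "u (b (n + 2)) \<in> P + Q + H"
      "\<forall>j\<in>{n + 2..2 * n}. u (b j) \<in> P + Q + H"
      using uP[of "n + 2"] uP P Q n2 by auto
    moreover have "span (b ` {1..n - 1}) \<subseteq> H" using H(2) Y n2 by simp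
    ultimately show ?thesis
      using HS sum_is_everything[OF pin n_def n2 u subS H(1)] by blast
  qed
  then show ?thesis by (simp add: P_def Q_def)
qed

section \<open>Cyclic order on the boundary circle\<close>

lemma unit_complex_arc:
  assumes "norm v = 1" "norm w = 1" "v \<noteq> w" "v = cis r"
  obtains s where "r < s" "s < r + 2 * pi" "w = cis s"
proof -
  have "norm (w / v) = 1" using assms by (simp add: norm_divide)
  then have "(Re (w / v))\<^sup>2 + (Im (w / v))\<^sup>2 = 1" by (simp add: cmod_power2[symmetric])
  then obtain t where t: "0 \<le> t" "t < 2 * pi" "Re (w / v) = cos t" "Im (w / v) = sin t"
    using sincos_total_2pi by metis
  then have "w / v = cis t" by (simp add: complex_eq_iff)
  then have w: "w = cis (r + t)" using assms by (simp add: field_simps cis_mult[symmetric])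
  have "t \<noteq> 0" using w assms by auto
  then show thesis using that[of "r + t"] t w by simp
qed

lemma positively_ordered_cases:
  assumes "\<theta> x \<in> sphere 0 1" "\<theta> y \<in> sphere 0 1" "\<theta> z \<in> sphere 0 1"
    and "\<theta> x \<noteq> \<theta> y" "\<theta> y \<noteq> \<theta> z" "\<theta> x \<noteq> \<theta> z"
  shows "positively_ordered \<theta> y z x \<or> positively_ordered \<theta> y x z"
proof -
  have norms: "norm (\<theta> x) = 1" "norm (\<theta> y) = 1" "norm (\<theta> z) = 1" using assms by auto
  obtain r where r: "\<theta> y = cis r"
    using norms(2) by (metis cis_Arg norm_zero zero_neq_one sgn_div_norm scaleR_one inverse_1)
  obtain s where s: "r < s" "s < r + 2 * pi" "\<theta> z = cis s"
    using unit_complex_arc[OF norms(2,3) assms(5) r] by blast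
  obtain t where t: "r < t" "t < r + 2 * pi" "\<theta> x = cis t"
    using unit_complex_arc[OF norms(2,1) assms(4)[symmetric] r] by blast
  have "s \<noteq> t" using s t assms(6) by auto
  then show ?thesis
    unfolding positively_ordered_def using r s t by (metis linorder_neqE_linordered_idom)
qed

theorem corollary3p7:
  fixes n g :: nat
    and S :: "'s::t2_space set"
    and \<A> :: "('s set \<times> ('s \<Rightarrow> complex)) set"
    and s\<^sub>0 :: 's
    and \<Gamma> :: "(real \<Rightarrow> 's) set monoid"
    and A :: "(real \<Rightarrow> 's) set set"
    and \<tau> :: "(real ^ 2 ^ 2) set \<Rightarrow> 'n::finite mat2 set"
    and \<rho> :: "(real \<Rightarrow> 's) set \<Rightarrow> 'n mat2 set"
    and \<theta> :: "(nat \<Rightarrow> (real \<Rightarrow> 's) set) set \<Rightarrow> complex"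
    and \<xi> :: "(nat \<Rightarrow> (real \<Rightarrow> 's) set) set \<Rightarrow> 'n flag"
  assumes "n = CARD('n)" and "n \<ge> 2"
    and "closed_oriented_surface g S \<A>" and "g \<ge> 2"
    and "s\<^sub>0 \<in> S" and "\<Gamma> = fundamental_group S s\<^sub>0"
    and "finite A" and "A \<subseteq> carrier \<Gamma>" and "generate \<Gamma> A = carrier \<Gamma>"
    and "principal_embedding \<tau>" and "hitchin_representation S \<A> s\<^sub>0 \<tau> \<rho>"
    and "homeomorphic_map (boundary_top \<Gamma> A) (top_of_set (sphere 0 1)) \<theta>"
    and "positive_curve \<Gamma> A \<theta> \<rho> \<xi>"
  shows "\<forall>x\<in>gromov_boundary \<Gamma> A. \<forall>y\<in>gromov_boundary \<Gamma> A. \<forall>z\<in>gromov_boundary \<Gamma> A.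
    x \<noteq> y \<and> y \<noteq> z \<and> x \<noteq> z \<longrightarrow>
      fsub (\<xi> x) (n - 1) + (fsub (\<xi> z) (n - 1) \<inter> fsub (\<xi> y) (n + 2)) + fpos (\<xi> y) = UNIV \<and>
      fsub (\<xi> x) (n - 1) + (fsub (\<xi> z) (n - 1) \<inter> fsub (\<xi> y) (n + 2)) + fneg (\<xi> y) = UNIV"
proof (intro ballI impI)
  fix x y z
  assume x: "x \<in> gromov_boundary \<Gamma> A" and y: "y \<in> gromov_boundary \<Gamma> A"
    and z: "z \<in> gromov_boundary \<Gamma> A" and distinct: "x \<noteq> y \<and> y \<noteq> z \<and> x \<noteq> z"
  have inj: "inj_on \<theta> (gromov_boundary \<Gamma> A)" and img: "\<theta> ` gromov_boundary \<Gamma> A = sphere 0 1"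
    using homeomorphic_imp_injective_map[OF assms(12)] homeomorphic_imp_surjective_map[OF assms(12)]
    by (simp_all add: topspace_boundary_top)
  have "\<theta> x \<in> sphere 0 1" "\<theta> y \<in> sphere 0 1" "\<theta> z \<in> sphere 0 1"
    using img x y z by blast+
  moreover have "\<theta> x \<noteq> \<theta> y" "\<theta> y \<noteq> \<theta> z" "\<theta> x \<noteq> \<theta> z"
    using inj_onD[OF inj] x y z distinct by blast+
  ultimately have "positively_ordered \<theta> y z x \<or> positively_ordered \<theta> y x z"
    by (rule positively_ordered_cases)
  then have pos: "positive_triple (\<xi> y) (\<xi> z) (\<xi> x) \<or> positive_triple (\<xi> y) (\<xi> x) (\<xi> z)"
    using assms(13) x y z unfolding positive_curve_def by blast
  then have "\<xi> y \<in> flags" by (auto simp: positive_triple_def)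
  then have "isotropic_plane n (fpos (\<xi> y))" "fsub (\<xi> y) (n - 1) \<subseteq> fpos (\<xi> y)"
    "isotropic_plane n (fneg (\<xi> y))" "fsub (\<xi> y) (n - 1) \<subseteq> fneg (\<xi> y)"
    unfolding assms(1)
    by (auto simp: flags_def positive_plane_def negative_plane_def signed_plane_def)
  then show "fsub (\<xi> x) (n - 1) + (fsub (\<xi> z) (n - 1) \<inter> fsub (\<xi> y) (n + 2)) + fpos (\<xi> y) = UNIV \<and>
      fsub (\<xi> x) (n - 1) + (fsub (\<xi> z) (n - 1) \<inter> fsub (\<xi> y) (n + 2)) + fneg (\<xi> y) = UNIV"
    using positive_triple_sum[OF assms(1,2) pos] by blast
qed

end
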